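(* Let $p\in(0,1)$ be constant. Starting from the unit mass $\delta_o$ at the origin $o$ of the comb graph $\mathbb{C}_2$, the minimum number of toppling moves needed to transport mass $p$ to distance at least $n$ from the origin satisfies $$N_p(\mathbb{C}_2,B_n,\delta_o)=\Theta(n^{7/2}),$$ i.e. there exist constants $0<c\le C<\infty$ and $n_0$, depending only on $p$, such that $c\,n^{7/2}\le N_p(\mathbb{C}_2,B_n,\delta_o)\le C\,n^{7/2}$ for all integers $n\ge n_0$.
   Context: The comb graph $\mathbb{C}_2$ is obtained from the square lattice $\mathbb{Z}^2$ (nearest-neighbour graph) by removing all horizontal edges except those on the $x$-axis; its origin is $o=(0,0)$. Toppling: let $G=(V,E)$ be a connected, locally finite graph, and write $y\sim v$ when $y,v$ are adjacent and $\mathcal{N}_v=\{y:y\sim v\}$. A mass distribution is a function $\mu:V\to[0,\infty)$. For a vertex $v$ with $\mu(v)>0$ and $0<m\le\mu(v)$, the toppling move $T_v^m$ topples mass $m$ at $v$ equally to its neighbours: $T_v^m\mu=\mu-m\delta_v+\frac{m}{|\mathcal{N}_v|}\sum_{y\sim v}\delta_y$. For $A\subset V$, $p>0$ and an initial mass distribution $\mu_0$, $N_p(G,A,\mu_0)$ is the minimum number of successive toppling moves needed to obtain from $\mu_0$ a mass distribution $\mu$ with $\sum_{v\notin A}\mu(v)\ge p$ (and $\infty$ if this is impossible). $B_n=\{u\in V: d_G(u,o)<n\}$ is the open ball of radius $n$ around $o$ in the graph distance $d_G$ (here $G=\mathbb{C}_2$). *)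

theory Defs
  imports "HOL-Analysis.Infinite_Sum" "HOL-Library.Extended_Nonnegative_Real"
begin

text \<open>
  A simple graph is given by its adjacency relation; its vertex set is the whole type
  \<open>'v\<close>. The definitions of the toppling process make sense for any adjacency relation;
  the standing assumptions on graphs are collected in the following locale.
\<close>

type_synonym 'v graph = "'v \<Rightarrow> 'v \<Rightarrow> bool"

definition neighbours :: "'v graph \<Rightarrow> 'v \<Rightarrow> 'v set" where
  "neighbours G v = {y. G v y}"

locale connected_locally_finite_graph =
  fixes G :: "'v graph"
  assumes sym: "G u v \<Longrightarrow> G v u"
    and irrefl: "\<not> G v v"
    and locally_finite: "finite (neighbours G v)"
    and connected: "G\<^sup>*\<^sup>* u v"

text \<open>
  \<open>(G ^^ k) u v\<close> says that there is a walk of length \<open>k\<close> from \<open>u\<close> to \<open>v\<close>. The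
  infimum is \<open>\<infinity>\<close> when there is no walk at all.
\<close>

definition graph_dist :: "'v graph \<Rightarrow> 'v \<Rightarrow> 'v \<Rightarrow> enat" where
  "graph_dist G u v = (INF k \<in> {k. (G ^^ k) u v}. enat k)"

definition graph_ball :: "'v graph \<Rightarrow> 'v \<Rightarrow> nat \<Rightarrow> 'v set" where
  "graph_ball G w n = {u. graph_dist G u w < enat n}"

definition unit_mass :: "'v \<Rightarrow> 'v \<Rightarrow> real" where
  "unit_mass v = (\<lambda>x. if x = v then 1 else 0)"

definition topple :: "'v graph \<Rightarrow> 'v \<Rightarrow> real \<Rightarrow> ('v \<Rightarrow> real) \<Rightarrow> ('v \<Rightarrow> real)" where
  "topple G v m \<mu> = (\<lambda>x. \<mu> x - m * unit_mass v x
      + m / real (card (neighbours G v)) * (\<Sum>y\<in>neighbours G v. unit_mass y x))"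

definition toppling_move :: "'v graph \<Rightarrow> ('v \<Rightarrow> real) \<Rightarrow> ('v \<Rightarrow> real) \<Rightarrow> bool" where
  "toppling_move G \<mu> \<mu>' \<longleftrightarrow> (\<exists>v m. 0 < m \<and> m \<le> \<mu> v \<and> \<mu>' = topple G v m \<mu>)"

text \<open>
  The mass outside \<open>A\<close> is summed in \<^typ>\<open>ennreal\<close>, where every family is summable,
  because a general initial distribution may have infinite total mass. As
  \<^typ>\<open>enat\<close> is well-ordered, the infimum is a minimum unless the set is empty,
  in which case it is \<open>\<infinity>\<close>. Mass distributions are nonnegative: this is required of the
  initial distribution \<open>\<mu>\<^sub>0\<close> and preserved by toppling moves.
\<close>

definition toppling_number :: "real \<Rightarrow> 'v graph \<Rightarrow> 'v set \<Rightarrow> ('v \<Rightarrow> real) \<Rightarrow> enat" where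
  "toppling_number p G A \<mu>\<^sub>0 =
     (INF k \<in> {k. \<exists>\<mu>. (toppling_move G ^^ k) \<mu>\<^sub>0 \<mu>
                     \<and> (\<Sum>\<^sub>\<infinity>v\<in>-A. ennreal (\<mu> v)) \<ge> ennreal p}. enat k)"

definition square_lattice :: "(int \<times> int) graph" where
  "square_lattice u v \<longleftrightarrow> \<bar>fst u - fst v\<bar> + \<bar>snd u - snd v\<bar> = 1"

definition comb :: "(int \<times> int) graph" where
  "comb u v \<longleftrightarrow> square_lattice u v \<and> \<not> (snd u = snd v \<and> snd u \<noteq> 0)"

lemma toppling_move_nonneg:
  assumes "toppling_move G \<mu> \<mu>'" and "\<And>x. 0 \<le> \<mu> x"
  shows "0 \<le> \<mu>' x"
proof -
  obtain v m where vm: "0 < m" "m \<le> \<mu> v" "\<mu>' = topple G v m \<mu>"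
    using assms(1) by (auto simp: toppling_move_def)
  have "0 \<le> \<mu> x - m * unit_mass v x"
    using vm(2) assms(2)[of x] by (auto simp: unit_mass_def)
  moreover have "0 \<le> m / real (card (neighbours G v)) * (\<Sum>y\<in>neighbours G v. unit_mass y x)"
    using vm(1) by (intro mult_nonneg_nonneg sum_nonneg) (auto simp: unit_mass_def)
  ultimately show ?thesis
    by (simp add: vm(3) topple_def)
qed

lemma comb_vertical: "comb\<^sup>*\<^sup>* (x, 0) (x, y)"
proof (induction y rule: int_induct[where k = 0])
  case (step1 i)
  have "comb (x, i) (x, i + 1)" by (simp add: comb_def square_lattice_def)
  with step1 show ?case by (meson rtranclp.rtrancl_into_rtrancl)
next
  case (step2 i)
  have "comb (x, i) (x, i - 1)" by (simp add: comb_def square_lattice_def)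
  with step2 show ?case by (meson rtranclp.rtrancl_into_rtrancl)
qed auto

lemma comb_horizontal: "comb\<^sup>*\<^sup>* (0, 0) (x, 0)"
proof (induction x rule: int_induct[where k = 0])
  case (step1 i)
  have "comb (i, 0) (i + 1, 0)" by (simp add: comb_def square_lattice_def)
  with step1 show ?case by (meson rtranclp.rtrancl_into_rtrancl)
next
  case (step2 i)
  have "comb (i, 0) (i - 1, 0)" by (simp add: comb_def square_lattice_def)
  with step2 show ?case by (meson rtranclp.rtrancl_into_rtrancl)
qed auto

lemma connected_locally_finite_graph_comb: "connected_locally_finite_graph comb"
proof
  have sym: "comb v u" if "comb u v" for u v
    using that by (auto simp: comb_def square_lattice_def abs_minus_commute)
  then show "comb u v \<Longrightarrow> comb v u" for u v .
  show "\<not> comb v v" for v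
    by (simp add: comb_def square_lattice_def)
  show "finite (neighbours comb v)" for v
  proof (rule finite_subset)
    show "neighbours comb v \<subseteq> {fst v - 1..fst v + 1} \<times> {snd v - 1..snd v + 1}"
      by (auto simp: neighbours_def comb_def square_lattice_def)
  qed simp
  have o: "comb\<^sup>*\<^sup>* (0, 0) v" for v
    using comb_horizontal[of "fst v"] comb_vertical[of "fst v" "snd v"] by simp
  have "symp comb" using sym by (simp add: symp_def)
  then have "comb\<^sup>*\<^sup>* u (0, 0)" for u
    using o[of u] by (meson symp_rtranclp sympD)
  then show "comb\<^sup>*\<^sup>* u v" for u v
    using o[of v] by (meson rtranclp_trans)
qed

end

(*
  Toppling mass m at v changes the mu-average of a function f by m times its Laplacian at v.

  Upper bound: greedily topple all the mass of the heaviest vertex of the box |x| <= K sqrt n,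
  |y| < n. Since x^2 - |y| is harmonic, the average of x^2 equals that of |y|, which is at most n,
  so little mass leaves through the sides. As long as a fixed amount of mass remains in the box,
  every move raises the average of y^2 by at least a constant times n^(-3/2), and this average
  cannot exceed n^2.

  Lower bound: the comb is a tree, and g(u,v) = d(u,v) - |y_u| - |y_v| is a potential kernel: its
  Laplacian in either variable is concentrated on the diagonal. Hence moves of masses m_1, ..., m_k
  raise the energy, the sum of g(u,v) mu(u) mu(v), to at least half the sum of the m_i^2. On the
  other hand the energy is at most twice the average of |x|, which is at most M^(1/4), where M is
  the average of x^2 + y^2 and equals the sum of the m_i. By Cauchy-Schwarz M^2 <= 4 k M^(1/4),
  while M is of order at least n^2.
*)

theory Submission
  imports Defs
begin

section \<open>Integrals against a finitely supported mass distribution\<close>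

text \<open>Summing over the support gives a finite sum for every distribution reached from a point
  mass, while the test function \<open>f\<close> may be unbounded.\<close>

definition mass_sum :: "('v \<Rightarrow> real) \<Rightarrow> ('v \<Rightarrow> real) \<Rightarrow> real" where
  "mass_sum f \<mu> = (\<Sum>v | \<mu> v \<noteq> 0. \<mu> v * f v)"

definition mass_distribution :: "('v \<Rightarrow> real) \<Rightarrow> bool" where
  "mass_distribution \<mu> \<longleftrightarrow> finite {v. \<mu> v \<noteq> 0} \<and> (\<forall>v. 0 \<le> \<mu> v)"

text \<open>The normalised Laplacian: the generator of simple random walk.\<close>

definition laplacian :: "'v graph \<Rightarrow> ('v \<Rightarrow> real) \<Rightarrow> 'v \<Rightarrow> real" where
  "laplacian G f v = (\<Sum>y\<in>neighbours G v. f y) / real (card (neighbours G v)) - f v"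

lemma mass_sum_eq_sum:
  assumes "finite A" "{v. \<mu> v \<noteq> 0} \<subseteq> A"
  shows "mass_sum f \<mu> = (\<Sum>v\<in>A. \<mu> v * f v)"
  unfolding mass_sum_def using assms by (intro sum.mono_neutral_left) auto

lemma mass_sum_add: "mass_sum (\<lambda>v. f v + g v) \<mu> = mass_sum f \<mu> + mass_sum g \<mu>"
  by (simp add: mass_sum_def sum.distrib algebra_simps)

lemma mass_sum_diff: "mass_sum (\<lambda>v. f v - g v) \<mu> = mass_sum f \<mu> - mass_sum g \<mu>"
  by (simp add: mass_sum_def sum_subtractf algebra_simps)

lemma mass_sum_cmult: "mass_sum (\<lambda>v. c * f v) \<mu> = c * mass_sum f \<mu>"
  by (simp add: mass_sum_def sum_distrib_left algebra_simps)

lemma mass_sum_const: "mass_sum (\<lambda>v. c) \<mu> = c * mass_sum (\<lambda>v. 1) \<mu>"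
  using mass_sum_cmult[of c "\<lambda>v. 1" \<mu>] by simp

lemma mass_sum_divide: "mass_sum (\<lambda>v. f v / c) \<mu> = mass_sum f \<mu> / c"
  by (simp add: mass_sum_def sum_divide_distrib)

lemma mass_sum_sum: "mass_sum (\<lambda>v. \<Sum>y\<in>A. f y v) \<mu> = (\<Sum>y\<in>A. mass_sum (f y) \<mu>)"
  unfolding mass_sum_def by (subst sum.swap) (simp add: sum_distrib_left)

lemma mass_sum_mono:
  assumes "mass_distribution \<mu>" "\<And>v. \<mu> v \<noteq> 0 \<Longrightarrow> f v \<le> g v"
  shows "mass_sum f \<mu> \<le> mass_sum g \<mu>"
  unfolding mass_sum_def using assms
  by (intro sum_mono mult_left_mono) (auto simp: mass_distribution_def)

lemma mass_sum_point:
  assumes "mass_distribution \<mu>"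
  shows "mass_sum (\<lambda>u. if u = v then c else 0) \<mu> = c * \<mu> v"
proof -
  have "mass_sum (\<lambda>u. if u = v then c else 0) \<mu> = (\<Sum>u\<in>insert v {v. \<mu> v \<noteq> 0}. \<mu> u * (if u = v then c else 0))"
    using assms by (intro mass_sum_eq_sum) (auto simp: mass_distribution_def)
  also have "\<dots> = (\<Sum>u\<in>insert v {v. \<mu> v \<noteq> 0}. if u = v then c * \<mu> u else 0)"
    by (intro sum.cong) auto
  also have "\<dots> = c * \<mu> v"
    using assms by (simp add: mass_distribution_def sum.delta)
  finally show ?thesis .
qed

text \<open>Nonnegativity of the variance: integrate
  \<open>2 * c * f v \<le> (f v)\<^sup>2 + c\<^sup>2\<close>, with \<open>c\<close> the mean of
  \<open>f\<close>.\<close>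

lemma mass_sum_square:
  assumes "mass_distribution \<mu>" "mass_sum (\<lambda>v. 1) \<mu> = 1"
  shows "(mass_sum f \<mu>)\<^sup>2 \<le> mass_sum (\<lambda>v. (f v)\<^sup>2) \<mu>"
proof -
  define c where "c = mass_sum f \<mu>"
  have "mass_sum (\<lambda>v. 2 * c * f v) \<mu> \<le> mass_sum (\<lambda>v. (f v)\<^sup>2 + c\<^sup>2) \<mu>"
    using assms(1)
  proof (rule mass_sum_mono)
    show "2 * c * f v \<le> (f v)\<^sup>2 + c\<^sup>2" for v
      using sum_squares_bound[of c "f v"] by simp
  qed
  then have "2 * c * c \<le> mass_sum (\<lambda>v. (f v)\<^sup>2) \<mu> + c\<^sup>2"
    by (simp add: mass_sum_cmult mass_sum_add mass_sum_const[of "c\<^sup>2"] assms(2) flip: c_def)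
  then show ?thesis
    by (simp add: c_def power2_eq_square)
qed

lemma infsum_ennreal_eq_mass_sum:
  assumes "mass_distribution \<mu>"
  shows "(\<Sum>\<^sub>\<infinity>v\<in>A. ennreal (\<mu> v)) = ennreal (mass_sum (indicator A) \<mu>)"
proof -
  let ?S = "{v. \<mu> v \<noteq> 0}"
  have fin: "finite ?S" and nonneg: "\<And>v. 0 \<le> \<mu> v"
    using assms by (auto simp: mass_distribution_def)
  have "(\<Sum>\<^sub>\<infinity>v\<in>A. ennreal (\<mu> v)) = (\<Sum>\<^sub>\<infinity>v\<in>?S. ennreal (\<mu> v * indicator A v))"
    by (rule infsum_cong_neutral) (auto simp: indicator_def)
  also have "\<dots> = ennreal (mass_sum (indicator A) \<mu>)"
    using fin nonneg by (simp add: mass_sum_def indicator_def)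
  finally show ?thesis .
qed

section \<open>Effect of one toppling move\<close>

lemma support_topple:
  "{x. topple G v m \<mu> x \<noteq> 0} \<subseteq> {v. \<mu> v \<noteq> 0} \<union> {v} \<union> neighbours G v"
proof
  fix x assume "x \<in> {x. topple G v m \<mu> x \<noteq> 0}"
  then have nz: "topple G v m \<mu> x \<noteq> 0" by simp
  show "x \<in> {v. \<mu> v \<noteq> 0} \<union> {v} \<union> neighbours G v"
  proof (rule ccontr)
    assume x: "x \<notin> {v. \<mu> v \<noteq> 0} \<union> {v} \<union> neighbours G v"
    then have "(\<Sum>y\<in>neighbours G v. unit_mass y x) = 0"
      by (intro sum.neutral) (auto simp: unit_mass_def)
    with nz x show False by (simp add: topple_def unit_mass_def)
  qed
qed

lemma mass_distribution_topple:
  assumes "mass_distribution \<mu>" "finite (neighbours G v)" "0 < m" "m \<le> \<mu> v"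
  shows "mass_distribution (topple G v m \<mu>)"
proof -
  have "toppling_move G \<mu> (topple G v m \<mu>)"
    using assms by (auto simp: toppling_move_def)
  then have "0 \<le> topple G v m \<mu> x" for x
    using assms(1) by (intro toppling_move_nonneg) (auto simp: mass_distribution_def)
  moreover have "finite {x. topple G v m \<mu> x \<noteq> 0}"
    using assms by (intro finite_subset[OF support_topple]) (auto simp: mass_distribution_def)
  ultimately show ?thesis
    by (simp add: mass_distribution_def)
qed

text \<open>The toppled mass \<open>m\<close> stops contributing \<open>f v\<close> and contributes
  the mean of \<open>f\<close> over the neighbours of \<open>v\<close> instead.\<close>

lemma mass_sum_topple:
  assumes "mass_distribution \<mu>" "finite (neighbours G v)"
  shows "mass_sum f (topple G v m \<mu>) = mass_sum f \<mu> + m * laplacian G f v"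
proof -
  let ?N = "neighbours G v"
  \<comment> \<open>A finite set containing the supports before and after the move.\<close>
  define A where "A = {v. \<mu> v \<noteq> 0} \<union> {v} \<union> ?N"
  have NA: "?N \<subseteq> A" by (auto simp: A_def)
  have fin: "finite A" using assms by (simp add: A_def mass_distribution_def)
  have point: "(\<Sum>x\<in>A. unit_mass y x * f x) = f y" if "y \<in> A" for y
  proof -
    have "(\<Sum>x\<in>A. unit_mass y x * f x) = (\<Sum>x\<in>A. if x = y then f x else 0)"
      by (rule sum.cong) (auto simp: unit_mass_def)
    then show ?thesis using fin that by simp
  qed
  have "mass_sum f (topple G v m \<mu>) = (\<Sum>x\<in>A. topple G v m \<mu> x * f x)"
    using fin support_topple[of G v m \<mu>] by (intro mass_sum_eq_sum) (auto simp: A_def)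
  also have "\<dots> = (\<Sum>x\<in>A. \<mu> x * f x) - m * (\<Sum>x\<in>A. unit_mass v x * f x)
      + m / real (card ?N) * (\<Sum>x\<in>A. \<Sum>y\<in>?N. unit_mass y x * f x)"
    by (simp add: topple_def distrib_right left_diff_distrib sum.distrib sum_subtractf
        sum_distrib_right mult.assoc flip: sum_distrib_left sum_divide_distrib)
  also have "(\<Sum>x\<in>A. \<Sum>y\<in>?N. unit_mass y x * f x) = (\<Sum>y\<in>?N. f y)"
    by (subst sum.swap, rule sum.cong) (simp_all add: point subsetD[OF NA])
  also have "(\<Sum>x\<in>A. unit_mass v x * f x) = f v"
    by (rule point) (simp add: A_def)
  also have "(\<Sum>x\<in>A. \<mu> x * f x) = mass_sum f \<mu>"
    using fin by (intro mass_sum_eq_sum[symmetric]) (auto simp: A_def)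
  finally show ?thesis
    by (simp add: laplacian_def algebra_simps)
qed

lemma mass_distribution_unit_mass: "mass_distribution (unit_mass v)"
  by (simp add: mass_distribution_def unit_mass_def)

lemma mass_sum_unit_mass: "mass_sum f (unit_mass v) = f v"
  by (simp add: mass_sum_def unit_mass_def)

section \<open>Neighbours, walks and balls in the comb\<close>

lemma graph_ball_iff: "u \<in> graph_ball G w n \<longleftrightarrow> (\<exists>k<n. (G ^^ k) u w)"
  by (auto simp: graph_ball_def graph_dist_def INF_less_iff)

lemma neighbours_comb:
  "neighbours comb (x, y) =
     (if y = 0 then {(x - 1, 0), (x + 1, 0), (x, 1), (x, -1)} else {(x, y - 1), (x, y + 1)})"
  by (auto simp: neighbours_def comb_def square_lattice_def abs_if split: if_splits)

lemma finite_neighbours_comb: "finite (neighbours comb v)"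
  using connected_locally_finite_graph_comb
  by (rule connected_locally_finite_graph.locally_finite)

lemma laplacian_comb:
  "laplacian comb f (x, y) =
     (if y = 0 then (f (x - 1, 0) + f (x + 1, 0) + f (x, 1) + f (x, -1)) / 4
      else (f (x, y - 1) + f (x, y + 1)) / 2) - f (x, y)"
  by (simp add: laplacian_def neighbours_comb)

lemma comb_vertical_walk: "(comb ^^ nat \<bar>y\<bar>) (x, y) (x, 0)"
proof (induction "nat \<bar>y\<bar>" arbitrary: y)
  case (Suc k)
  have "comb (x, y) (x, y - sgn y)"
    using Suc(2) by (auto simp: comb_def square_lattice_def sgn_if)
  moreover have k: "k = nat \<bar>y - sgn y\<bar>"
    using Suc(2) by (auto simp: sgn_if)
  have "(comb ^^ k) (x, y - sgn y) (x, 0)"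
    using Suc(1)[OF k] unfolding k[symmetric] .
  ultimately show ?case
    using Suc(2) by (metis relpowp_Suc_I2)
qed simp

lemma comb_horizontal_walk: "(comb ^^ nat \<bar>x\<bar>) (x, 0) (0, 0)"
proof (induction "nat \<bar>x\<bar>" arbitrary: x)
  case (Suc k)
  have "comb (x, 0) (x - sgn x, 0)"
    using Suc(2) by (auto simp: comb_def square_lattice_def sgn_if)
  moreover have k: "k = nat \<bar>x - sgn x\<bar>"
    using Suc(2) by (auto simp: sgn_if)
  have "(comb ^^ k) (x - sgn x, 0) (0, 0)"
    using Suc(1)[OF k] unfolding k[symmetric] .
  ultimately show ?case
    using Suc(2) by (metis relpowp_Suc_I2)
qed simp

lemma comb_walk_height: "(comb ^^ k) u v \<Longrightarrow> \<bar>snd u - snd v\<bar> \<le> int k"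
proof (induction k arbitrary: v)
  case (Suc k)
  from Suc.prems obtain w where "(comb ^^ k) u w" "comb w v" by (rule relpowp_Suc_E)
  then have "\<bar>snd u - snd w\<bar> \<le> int k" "\<bar>snd w - snd v\<bar> \<le> 1"
    using Suc.IH[of w] by (auto simp: comb_def[of w] square_lattice_def)
  then show ?case by simp
qed simp

text \<open>Walk down the tooth to the axis, then along the axis. The lower bound uses this
  inclusion; the upper bound uses the enclosing strip of \<open>comb_ball_height\<close>.\<close>

lemma comb_ball_memI:
  assumes "\<bar>x\<bar> + \<bar>y\<bar> < int n"
  shows "(x, y) \<in> graph_ball comb (0, 0) n"
proof -
  have "(comb ^^ (nat \<bar>y\<bar> + nat \<bar>x\<bar>)) (x, y) (0, 0)"
    using comb_vertical_walk comb_horizontal_walk by (auto simp: relpowp_add)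
  then show ?thesis
    using assms unfolding graph_ball_iff by (intro exI[of _ "nat \<bar>y\<bar> + nat \<bar>x\<bar>"]) auto
qed

lemma comb_ball_height: "u \<in> graph_ball comb (0, 0) n \<Longrightarrow> \<bar>snd u\<bar> < int n"
  using comb_walk_height[of _ u "(0, 0)"] by (force simp: graph_ball_iff)

section \<open>Laplacians of the test functions and of the potential kernel\<close>

lemma laplacian_square_norm:
  "laplacian comb (\<lambda>v. (real_of_int (fst v))\<^sup>2 + (real_of_int (snd v))\<^sup>2) u = 1"
  by (cases u) (simp add: laplacian_comb power2_eq_square algebra_simps)

text \<open>The value is 1 off the axis; on the axis only two of the four neighbours change the
  height, which leaves 1/2.\<close>

lemma laplacian_square_height:
  "1 / 2 \<le> laplacian comb (\<lambda>v. (real_of_int (snd v))\<^sup>2) u"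
  by (cases u) (simp add: laplacian_comb power2_eq_square algebra_simps)

text \<open>Both terms have Laplacian 1/2 on the axis and 0 off it.\<close>

lemma laplacian_square_abscissa_minus_height:
  "laplacian comb (\<lambda>v. (real_of_int (fst v))\<^sup>2 - \<bar>real_of_int (snd v)\<bar>) u = 0"
  by (cases u) (auto simp: laplacian_comb power2_eq_square field_simps abs_if)

(* Graph distance minus both heights; for different teeth the heights cancel. *)
definition comb_kernel :: "int \<times> int \<Rightarrow> int \<times> int \<Rightarrow> real" where
  "comb_kernel u v =
     (if fst u = fst v then \<bar>snd u - snd v\<bar> - \<bar>snd u\<bar> - \<bar>snd v\<bar> else \<bar>fst u - fst v\<bar>)"

lemma comb_kernel_sym: "comb_kernel u v = comb_kernel v u"
  by (simp add: comb_kernel_def abs_minus_commute)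

text \<open>On a common tooth the triangle inequality makes the kernel nonpositive; otherwise it is
  the triangle inequality for abscissas.\<close>

lemma comb_kernel_le: "comb_kernel u v \<le> \<bar>fst u\<bar> + \<bar>fst v\<bar>"
  unfolding comb_kernel_def by (auto simp flip: of_int_add)

text \<open>This is 2 divided by the degree.\<close>

definition comb_weight :: "int \<times> int \<Rightarrow> real" where
  "comb_weight u = (if snd u = 0 then 1 / 2 else 1)"

text \<open>In a tree, a vertex \<open>v\<close> other than \<open>u\<close> has one neighbour
  nearer to \<open>u\<close> and all others farther away, so the distance to \<open>u\<close> has
  Laplacian 1/2 on the axis and 0 off it, exactly as the height of \<open>v\<close> has. At
  \<open>u\<close> itself the distance has Laplacian 1.\<close>

lemma laplacian_comb_kernel:
  "laplacian comb (comb_kernel u) v = (if u = v then comb_weight v else 0)"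
proof -
  obtain x y x' y' where "u = (x, y)" "v = (x', y')" by fastforce
  then show ?thesis
    by (auto simp: laplacian_comb comb_kernel_def comb_weight_def abs_if field_simps)
qed

section \<open>The energy and its growth under toppling\<close>

definition comb_energy :: "(int \<times> int \<Rightarrow> real) \<Rightarrow> real" where
  "comb_energy \<mu> = mass_sum (\<lambda>u. mass_sum (comb_kernel u) \<mu>) \<mu>"

text \<open>The energy is a symmetric quadratic form, so the increment is
  \<open>comb_weight v * m\<close> times the sum of the masses at \<open>v\<close> before and after
  the move.\<close>

lemma comb_energy_topple:
  assumes "mass_distribution \<mu>" "0 < m" "m \<le> \<mu> v"
  shows "comb_energy (topple comb v m \<mu>) = comb_energy \<mu> + comb_weight v * (2 * \<mu> v - m) * m"
proof -
  define \<mu>' where "\<mu>' = topple comb v m \<mu>"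
  \<comment> \<open>The potential of \<mu>. By symmetry of the kernel, its Laplacian can be taken in
    the second argument, under the sum.\<close>
  define \<phi> where "\<phi> = (\<lambda>u. mass_sum (comb_kernel u) \<mu>)"
  have md': "mass_distribution \<mu>'"
    unfolding \<mu>'_def using assms by (intro mass_distribution_topple finite_neighbours_comb)
  have step: "mass_sum f \<mu>' = mass_sum f \<mu> + m * laplacian comb f v" for f
    unfolding \<mu>'_def using assms(1) finite_neighbours_comb by (rule mass_sum_topple)
  have "comb_kernel u = (\<lambda>v. comb_kernel v u)" for u
    by (rule ext) (rule comb_kernel_sym)
  then have \<phi>_swap: "\<phi> = (\<lambda>v. mass_sum (\<lambda>u. comb_kernel u v) \<mu>)"
    unfolding \<phi>_def by metis
  have lap: "laplacian comb \<phi> v = comb_weight v * \<mu> v"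
  proof -
    have "laplacian comb \<phi> v = mass_sum (\<lambda>u. laplacian comb (comb_kernel u) v) \<mu>"
      unfolding \<phi>_swap laplacian_def
      by (simp add: mass_sum_diff mass_sum_divide mass_sum_sum)
    also have "\<dots> = mass_sum (\<lambda>u. if u = v then comb_weight v else 0) \<mu>"
      by (simp add: laplacian_comb_kernel)
    finally show ?thesis by (simp add: mass_sum_point[OF assms(1)])
  qed
  \<comment> \<open>Without loops none of the toppled mass returns to \<open>v\<close>.\<close>
  have "v \<notin> neighbours comb v"
    by (simp add: neighbours_def comb_def square_lattice_def)
  then have "(\<Sum>y\<in>neighbours comb v. unit_mass y v) = 0"
    by (intro sum.neutral) (auto simp: unit_mass_def)
  then have \<mu>'_v: "\<mu>' v = \<mu> v - m"
    by (simp add: \<mu>'_def topple_def unit_mass_def)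
  \<comment> \<open>Pass from \<mu>' to \<mu> first in the inner sum, then in the outer one.\<close>
  have "comb_energy \<mu>' = mass_sum (\<lambda>u. \<phi> u + m * (if u = v then comb_weight v else 0)) \<mu>'"
    unfolding comb_energy_def step[of "comb_kernel _"] laplacian_comb_kernel \<phi>_def ..
  also have "\<dots> = mass_sum \<phi> \<mu>' + m * (comb_weight v * \<mu>' v)"
    by (simp only: mass_sum_add mass_sum_cmult mass_sum_point[OF md'])
  also have "mass_sum \<phi> \<mu>' = comb_energy \<mu> + m * (comb_weight v * \<mu> v)"
    by (simp add: step lap) (simp add: comb_energy_def \<phi>_def)
  finally show ?thesis
    by (simp add: \<mu>'_v algebra_simps flip: \<mu>'_def)
qed

lemma comb_energy_le:
  assumes "mass_distribution \<mu>" "mass_sum (\<lambda>v. 1) \<mu> = 1"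
  shows "comb_energy \<mu> \<le> 2 * mass_sum (\<lambda>v. \<bar>real_of_int (fst v)\<bar>) \<mu>"
proof -
  let ?a = "\<lambda>v. \<bar>real_of_int (fst v)\<bar>"
  have "mass_sum (comb_kernel u) \<mu> \<le> ?a u + mass_sum ?a \<mu>" for u
  proof -
    have "mass_sum (comb_kernel u) \<mu> \<le> mass_sum (\<lambda>v. ?a u + ?a v) \<mu>"
      using assms(1) by (rule mass_sum_mono) (use comb_kernel_le in simp)
    then show ?thesis by (simp add: mass_sum_add mass_sum_const[of "?a u"] assms(2))
  qed
  then have "comb_energy \<mu> \<le> mass_sum (\<lambda>u. ?a u + mass_sum ?a \<mu>) \<mu>"
    unfolding comb_energy_def using assms(1) by (intro mass_sum_mono)
  then show ?thesis
    by (simp add: mass_sum_add mass_sum_const[of "mass_sum ?a \<mu>"] assms(2))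
qed

section \<open>Invariants and the lower bound\<close>

text \<open>The functions 1 and \<open>x^2 - |y|\<close> are harmonic, so their averages keep their
  values at the origin.\<close>

lemma comb_reachable:
  assumes "(toppling_move comb ^^ k) (unit_mass (0, 0)) \<mu>"
  shows "mass_distribution \<mu>" "mass_sum (\<lambda>v. 1) \<mu> = 1"
    "mass_sum (\<lambda>v. (real_of_int (fst v))\<^sup>2) \<mu> = mass_sum (\<lambda>v. \<bar>real_of_int (snd v)\<bar>) \<mu>"
proof -
  have "mass_distribution \<mu> \<and> mass_sum (\<lambda>v. 1) \<mu> = 1 \<and>
      mass_sum (\<lambda>v. (real_of_int (fst v))\<^sup>2 - \<bar>real_of_int (snd v)\<bar>) \<mu> = 0"
    using assms
  proof (induction k arbitrary: \<mu>)
    case 0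
    then show ?case
      by (auto simp: mass_distribution_unit_mass mass_sum_unit_mass)
  next
    case (Suc k)
    from Suc.prems obtain \<nu>
      where \<nu>: "(toppling_move comb ^^ k) (unit_mass (0, 0)) \<nu>" "toppling_move comb \<nu> \<mu>"
      by (rule relpowp_Suc_E)
    then obtain v m where vm: "0 < m" "m \<le> \<nu> v" "\<mu> = topple comb v m \<nu>"
      by (auto simp: toppling_move_def)
    have "laplacian comb (\<lambda>v. 1) v = 0"
      by (cases v) (simp add: laplacian_comb)
    with Suc.IH[OF \<nu>(1)] vm show ?case
      by (simp add: mass_distribution_topple finite_neighbours_comb mass_sum_topple
          laplacian_square_abscissa_minus_height)
  qed
  then show "mass_distribution \<mu>" "mass_sum (\<lambda>v. 1) \<mu> = 1"
    "mass_sum (\<lambda>v. (real_of_int (fst v))\<^sup>2) \<mu> = mass_sum (\<lambda>v. \<bar>real_of_int (snd v)\<bar>) \<mu>"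
    by (auto simp: mass_sum_diff)
qed

text \<open>Cauchy-Schwarz for the toppled masses, whose sum is \<open>M\<close> and whose squares
  sum to at most twice the energy. Proving it move by move avoids recording the sequence of
  masses.\<close>

lemma comb_moves_energy:
  assumes "(toppling_move comb ^^ k) (unit_mass (0, 0)) \<mu>"
  defines "M \<equiv> mass_sum (\<lambda>v. (real_of_int (fst v))\<^sup>2 + (real_of_int (snd v))\<^sup>2) \<mu>"
  shows "0 \<le> M \<and> 0 \<le> comb_energy \<mu> \<and> M\<^sup>2 \<le> 2 * real k * comb_energy \<mu>"
  unfolding M_def using assms(1)
proof (induction k arbitrary: \<mu>)
  case 0
  then show ?case
    by (auto simp: mass_sum_unit_mass comb_energy_def comb_kernel_def)
next
  case (Suc k)
  from Suc.prems obtain \<nu>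
    where \<nu>: "(toppling_move comb ^^ k) (unit_mass (0, 0)) \<nu>" "toppling_move comb \<nu> \<mu>"
    by (rule relpowp_Suc_E)
  then obtain v m where vm: "0 < m" "m \<le> \<nu> v" "\<mu> = topple comb v m \<nu>"
    by (auto simp: toppling_move_def)
  define M' E where "M' = mass_sum (\<lambda>v. (real_of_int (fst v))\<^sup>2 + (real_of_int (snd v))\<^sup>2) \<nu>"
    and "E = 2 * comb_energy \<nu>"
  have md: "mass_distribution \<nu>" using \<nu>(1) by (rule comb_reachable)
  have IH: "0 \<le> M'" "0 \<le> E" "M'\<^sup>2 \<le> real k * E"
    using Suc.IH[OF \<nu>(1)] by (auto simp: M'_def E_def)
  have M: "mass_sum (\<lambda>v. (real_of_int (fst v))\<^sup>2 + (real_of_int (snd v))\<^sup>2) \<mu> = M' + m"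
    unfolding vm(3) M'_def
    by (simp add: mass_sum_topple[OF md finite_neighbours_comb] laplacian_square_norm)
  \<comment> \<open>The weight is at least 1/2, and \<open>m \<le> \<nu> v\<close> gives
    \<open>m \<le> 2 * \<nu> v - m\<close>.\<close>
  have "1 / 2 * m * m \<le> comb_weight v * (2 * \<nu> v - m) * m"
    using vm by (intro mult_right_mono mult_mono) (auto simp: comb_weight_def)
  then have E: "E + m\<^sup>2 \<le> 2 * comb_energy \<mu>"
    using comb_energy_topple[OF md vm(1,2)] by (simp add: vm(3) E_def power2_eq_square)
  \<comment> \<open>The cross term of \<open>(M' + m)\<^sup>2\<close>: the induction hypothesis
    bounds \<open>M'\<close> by the root of \<open>k * E\<close>, and the arithmetic-geometric mean
    inequality does the rest.\<close>
  have cs: "2 * M' * m \<le> E + real k * m\<^sup>2"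
  proof (rule power2_le_imp_le)
    have "(2 * M' * m)\<^sup>2 = 4 * m\<^sup>2 * M'\<^sup>2" by (simp add: power2_eq_square)
    also have "\<dots> \<le> 4 * m\<^sup>2 * (real k * E)" using IH(3) by (intro mult_left_mono) auto
    also have "\<dots> \<le> (E + real k * m\<^sup>2)\<^sup>2"
      using zero_le_power2[of "E - real k * m\<^sup>2"] by (simp add: power2_eq_square algebra_simps)
    finally show "(2 * M' * m)\<^sup>2 \<le> (E + real k * m\<^sup>2)\<^sup>2" .
  qed (use IH in simp)
  have "(M' + m)\<^sup>2 \<le> real (Suc k) * (E + m\<^sup>2)"
    using cs IH(3) by (simp add: power2_eq_square algebra_simps)
  also have "\<dots> \<le> real (Suc k) * (2 * comb_energy \<mu>)"
    using E by (intro mult_left_mono) auto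
  finally have "(M' + m)\<^sup>2 \<le> real (Suc k) * (2 * comb_energy \<mu>)" .
  moreover have "0 \<le> comb_energy \<mu>"
    using E IH(2) zero_le_power2[of m] by linarith
  ultimately show ?case
    using M IH(1) vm(1) by (simp only: M) (simp add: mult_ac)
qed

text \<open>With \<open>M\<close> at least \<open>p / 2 * n^2\<close>,
  \<open>M^2 \<le> 4 * k * X\<close> and \<open>X^4 \<le> M\<close> give
  \<open>M^7 \<le> (4 * k)^4\<close>; the fourth root explains the exponents 7/4 and 7/2.\<close>

lemma comb_moves_lower_bound:
  assumes reach: "(toppling_move comb ^^ k) (unit_mass (0, 0)) \<mu>"
    and p: "0 < p" "p \<le> mass_sum (indicator (- graph_ball comb (0, 0) n)) \<mu>"
  shows "(p / 2) powr (7 / 4) / 4 * real n powr (7 / 2) \<le> real k"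
\<comment> \<open>For \<open>n = 0\<close> the left-hand side is 0, since
  \<open>0 powr (7 / 2) = 0\<close>.\<close>
proof (cases "n = 0")
  case False
  define M where "M = mass_sum (\<lambda>v. (real_of_int (fst v))\<^sup>2 + (real_of_int (snd v))\<^sup>2) \<mu>"
  define X where "X = mass_sum (\<lambda>v. \<bar>real_of_int (fst v)\<bar>) \<mu>"
  define Y where "Y = mass_sum (\<lambda>v. \<bar>real_of_int (snd v)\<bar>) \<mu>"
  have md: "mass_distribution \<mu>" and one: "mass_sum (\<lambda>v. 1) \<mu> = 1"
    using comb_reachable[OF reach] by auto
  have "mass_sum (\<lambda>v. (real n)\<^sup>2 / 2 * indicator (- graph_ball comb (0, 0) n) v) \<mu> \<le> M"
    unfolding M_def using md
  proof (rule mass_sum_mono)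
    fix v :: "int \<times> int"
    obtain x y where v: "v = (x, y)" by fastforce
    show "(real n)\<^sup>2 / 2 * indicator (- graph_ball comb (0, 0) n) v
        \<le> (real_of_int (fst v))\<^sup>2 + (real_of_int (snd v))\<^sup>2"
    proof (cases "v \<in> graph_ball comb (0, 0) n")
      case False
      then have "int n \<le> \<bar>x\<bar> + \<bar>y\<bar>" using comb_ball_memI[of x y n] v by force
      then have "real n \<le> \<bar>real_of_int x\<bar> + \<bar>real_of_int y\<bar>" by linarith
      then have "(real n)\<^sup>2 \<le> (\<bar>real_of_int x\<bar> + \<bar>real_of_int y\<bar>)\<^sup>2"
        by (intro power_mono) auto
      also have "\<dots> \<le> 2 * ((real_of_int x)\<^sup>2 + (real_of_int y)\<^sup>2)"
        using sum_squares_bound[of "\<bar>real_of_int x\<bar>" "\<bar>real_of_int y\<bar>"] by (simp add: power2_sum)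
      finally show ?thesis using False v by simp
    qed simp
  qed
  then have "(real n)\<^sup>2 / 2 * mass_sum (indicator (- graph_ball comb (0, 0) n)) \<mu> \<le> M"
    by (simp only: mass_sum_cmult)
  moreover have "(real n)\<^sup>2 / 2 * p \<le> (real n)\<^sup>2 / 2 * mass_sum (indicator (- graph_ball comb (0, 0) n)) \<mu>"
    using p(2) by (rule mult_left_mono) simp
  ultimately have M_ge: "p / 2 * (real n)\<^sup>2 \<le> M" by (simp add: mult_ac)
  with p(1) False have "0 < M" by (smt (verit) half_gt_zero mult_pos_pos of_nat_0_less_iff gr0I zero_less_power)
  \<comment> \<open>The variance inequality is applied to \<open>|x|\<close> and then to
    \<open>|y|\<close>, linked by the invariant that equates the averages of \<open>x^2\<close> and
    \<open>|y|\<close>.\<close>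
  have XY: "X\<^sup>2 \<le> Y"
    using mass_sum_square[OF md one, of "\<lambda>v. \<bar>real_of_int (fst v)\<bar>"] comb_reachable(3)[OF reach]
    by (simp add: X_def Y_def)
  have "Y\<^sup>2 \<le> mass_sum (\<lambda>v. (real_of_int (snd v))\<^sup>2) \<mu>"
    using mass_sum_square[OF md one, of "\<lambda>v. \<bar>real_of_int (snd v)\<bar>"] by (simp add: Y_def)
  also have "\<dots> \<le> M"
    unfolding M_def using md by (rule mass_sum_mono) simp
  finally have "Y\<^sup>2 \<le> M" .
  moreover have "(X\<^sup>2)\<^sup>2 \<le> Y\<^sup>2" using XY by (rule power_mono) simp
  ultimately have X4: "X ^ 4 \<le> M" by (simp flip: power_mult)
  have "M\<^sup>2 \<le> 2 * real k * comb_energy \<mu>"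
    using comb_moves_energy[OF reach] by (simp add: M_def)
  also have "\<dots> \<le> 2 * real k * (2 * X)"
    using comb_energy_le[OF md one] by (intro mult_left_mono) (auto simp: X_def)
  \<comment> \<open>Fourth powers allow \<open>X\<close> to be replaced without taking roots; one
    factor \<open>M\<close> then cancels.\<close>
  finally have "(M\<^sup>2) ^ 4 \<le> (4 * real k * X) ^ 4"
    by (intro power_mono) auto
  also have "\<dots> = (4 * real k) ^ 4 * X ^ 4" by (rule power_mult_distrib)
  also have "\<dots> \<le> (4 * real k) ^ 4 * M" using X4 by (intro mult_left_mono) auto
  finally have "M ^ 7 * M \<le> (4 * real k) ^ 4 * M"
    by (simp flip: power_mult power_Suc2)
  then have "M ^ 7 \<le> (4 * real k) ^ 4" using \<open>0 < M\<close> by simp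
  moreover have "(p / 2 * (real n)\<^sup>2) ^ 7 \<le> M ^ 7" using M_ge p(1) by (intro power_mono) auto
  moreover have "((p / 2) powr (7 / 4)) ^ 4 = (p / 2) ^ 7" "(real n powr (7 / 2)) ^ 4 = real n ^ 14"
    using p(1) False by (simp_all add: powr_power)
  then have "((p / 2) powr (7 / 4) * real n powr (7 / 2)) ^ 4 = (p / 2 * (real n)\<^sup>2) ^ 7"
    unfolding power_mult_distrib by (simp flip: power_mult)
  ultimately have "((p / 2) powr (7 / 4) * real n powr (7 / 2)) ^ 4 \<le> (4 * real k) ^ 4"
    by linarith
  then have "(p / 2) powr (7 / 4) * real n powr (7 / 2) \<le> 4 * real k"
    by (subst (asm) power_mono_iff) auto
  then show ?thesis by simp
qed simp

section \<open>The greedy strategy and the upper bound\<close>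

text \<open>Pigeonhole: less than \<open>p\<close> lies outside the ball and, by Chebyshev, at most
  \<open>(1 - p) / 2\<close> lies beyond the sides of the box \<open>D\<close>. More than
  \<open>(1 - p) / 2\<close> is left for its vertices, of which there are at most
  \<open>6 * K * n^(3/2)\<close>.\<close>

lemma comb_heavy_vertex:
  assumes reach: "(toppling_move comb ^^ k) (unit_mass (0, 0)) \<mu>"
    and supp: "\<And>v. \<mu> v \<noteq> 0 \<Longrightarrow> \<bar>snd v\<bar> \<le> int n"
    and p: "p < 1" "mass_sum (indicator (- graph_ball comb (0, 0) n)) \<mu> < p"
    and n: "0 < n" and K: "1 \<le> K" "1 / K\<^sup>2 \<le> (1 - p) / 2"
  shows "\<exists>v. \<bar>snd v\<bar> < int n \<and> (1 - p) / (12 * K * (real n * sqrt (real n))) \<le> \<mu> v"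
proof (rule ccontr)
  assume light: "\<not> ?thesis"
  define \<delta> where "\<delta> = (1 - p) / (12 * K * (real n * sqrt (real n)))"
  define R where "R = \<lfloor>K * sqrt (real n)\<rfloor>"
  define D where "D = {-R..R} \<times> {1 - int n..int n - 1}"
  have md: "mass_distribution \<mu>" and one: "mass_sum (\<lambda>v. 1) \<mu> = 1"
    using comb_reachable[OF reach] by auto
  have K0: "0 < K" using K by simp
  have sq1: "1 \<le> K * sqrt (real n)"
    using K n mult_mono[of 1 K 1 "sqrt (real n)"] by simp
  have R: "0 \<le> R" "real_of_int R \<le> K * sqrt (real n)" "K * sqrt (real n) < real_of_int R + 1"
    using sq1 by (auto simp: R_def)
  have "real (card D) = (2 * real_of_int R + 1) * (2 * real n - 1)"
    using R(1) n by (simp add: D_def card_cartesian_product of_nat_diff nat_diff_distrib)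
  \<comment> \<open>\<open>2 * R + 1\<close> is at most three times \<open>K * sqrt n\<close>,
    because \<open>K * sqrt n\<close> is at least 1.\<close>
  also have "\<dots> \<le> (3 * (K * sqrt (real n))) * (2 * real n)"
    using R n sq1 by (intro mult_mono) auto
  finally have card: "real (card D) \<le> 6 * K * (real n * sqrt (real n))"
    by (simp add: mult_ac)
  have "0 \<le> \<delta>" using p(1) K0 by (simp add: \<delta>_def)
  have "mass_sum (indicator D) \<mu> = (\<Sum>v\<in>{v. \<mu> v \<noteq> 0} \<union> D. \<mu> v * indicator D v)"
    using md by (intro mass_sum_eq_sum) (auto simp: D_def mass_distribution_def)
  also have "\<dots> = (\<Sum>v\<in>D. \<mu> v)"
    using md by (intro sum.mono_neutral_cong_right) (auto simp: D_def mass_distribution_def)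
  also have "\<dots> \<le> real (card D) * \<delta>"
  proof (rule sum_bounded_above)
    fix v assume "v \<in> D"
    then have "\<bar>snd v\<bar> < int n" by (auto simp: D_def)
    with light show "\<mu> v \<le> \<delta>" unfolding \<delta>_def by (meson linear)
  qed
  also have "\<dots> \<le> 6 * K * (real n * sqrt (real n)) * \<delta>"
    using card \<open>0 \<le> \<delta>\<close> by (rule mult_right_mono)
  also have "\<dots> = (1 - p) / 2"
    using K0 n by (simp add: \<delta>_def)
  finally have D_mass: "mass_sum (indicator D) \<mu> \<le> (1 - p) / 2" .
  \<comment> \<open>Each vertex is outside the ball, in \<open>D\<close>, or so far to the side that
    the quadratic term is at least 1.\<close>
  have "mass_sum (\<lambda>v. 1) \<mu> \<le> mass_sum (\<lambda>v. indicator (- graph_ball comb (0, 0) n) v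
      + (real_of_int (fst v))\<^sup>2 / (K\<^sup>2 * real n) + indicator D v) \<mu>"
    using md
  proof (rule mass_sum_mono)
    fix v :: "int \<times> int"
    obtain x y where v: "v = (x, y)" by fastforce
    show "1 \<le> indicator (- graph_ball comb (0, 0) n) v
        + (real_of_int (fst v))\<^sup>2 / (K\<^sup>2 * real n) + (indicator D v :: real)"
    proof (cases "v \<in> graph_ball comb (0, 0) n \<and> v \<notin> D")
      case True
      with comb_ball_height[of v n] have "R < \<bar>x\<bar>"
        by (auto simp: D_def v)
      then have "K * sqrt (real n) \<le> \<bar>real_of_int x\<bar>"
        using R(3) by linarith
      then have "(K * sqrt (real n))\<^sup>2 \<le> \<bar>real_of_int x\<bar>\<^sup>2"
        using sq1 by (intro power_mono) auto
      then have "1 \<le> (real_of_int x)\<^sup>2 / (K\<^sup>2 * real n)"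
        using K0 n by (simp add: power_mult_distrib)
      then show ?thesis by (simp add: v add_increasing add_increasing2)
    qed (auto simp: indicator_def add_increasing)
  qed
  then have "1 \<le> mass_sum (indicator (- graph_ball comb (0, 0) n)) \<mu>
      + mass_sum (\<lambda>v. \<bar>real_of_int (snd v)\<bar>) \<mu> / (K\<^sup>2 * real n) + mass_sum (indicator D) \<mu>"
    by (simp add: one mass_sum_add mass_sum_divide comb_reachable(3)[OF reach])
  moreover have "mass_sum (\<lambda>v. \<bar>real_of_int (snd v)\<bar>) \<mu> / (K\<^sup>2 * real n) \<le> 1 / K\<^sup>2"
  proof -
    have "mass_sum (\<lambda>v. \<bar>real_of_int (snd v)\<bar>) \<mu> \<le> mass_sum (\<lambda>v. real n) \<mu>"
      using md
    proof (rule mass_sum_mono)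
      show "\<bar>real_of_int (snd v)\<bar> \<le> real n" if "\<mu> v \<noteq> 0" for v
        using supp[OF that] by linarith
    qed
    then have "mass_sum (\<lambda>v. \<bar>real_of_int (snd v)\<bar>) \<mu> \<le> real n"
      by (simp add: mass_sum_const[of "real n"] one)
    then show ?thesis
      using K0 n by (simp add: field_simps)
  qed
  ultimately show False
    using D_mass K(2) p(2) by (simp add: field_simps)
qed

text \<open>While the target is missed, some vertex strictly inside the strip carries mass at least
  \<delta>. Toppling all of it raises the average of \<open>y^2\<close> by at least
  \<open>\<delta> / 2\<close>.\<close>

lemma comb_greedy:
  assumes p: "p < 1" and n: "0 < n" and K: "1 \<le> K" "1 / K\<^sup>2 \<le> (1 - p) / 2"
  defines "\<delta> \<equiv> (1 - p) / (12 * K * (real n * sqrt (real n)))"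
  shows "(\<exists>j\<le>k. \<exists>\<mu>. (toppling_move comb ^^ j) (unit_mass (0, 0)) \<mu>
        \<and> p \<le> mass_sum (indicator (- graph_ball comb (0, 0) n)) \<mu>) \<or>
    (\<exists>\<mu>. (toppling_move comb ^^ k) (unit_mass (0, 0)) \<mu>
        \<and> (\<forall>v. \<mu> v \<noteq> 0 \<longrightarrow> \<bar>snd v\<bar> \<le> int n)
        \<and> real k * \<delta> / 2 \<le> mass_sum (\<lambda>v. (real_of_int (snd v))\<^sup>2) \<mu>)"
proof (induction k)
  case 0
  show ?case
    by (rule disjI2, rule exI[of _ "unit_mass (0, 0)"])
      (simp add: mass_sum_unit_mass, simp add: unit_mass_def)
next
  case (Suc k)
  let ?out = "\<lambda>\<mu>. mass_sum (indicator (- graph_ball comb (0, 0) n)) \<mu>"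
  show ?case
  proof (cases "\<exists>j\<le>k. \<exists>\<mu>. (toppling_move comb ^^ j) (unit_mass (0, 0)) \<mu> \<and> p \<le> ?out \<mu>")
    case True
    then show ?thesis by (meson le_SucI)
  next
    case False
    with Suc.IH obtain \<mu> where reach: "(toppling_move comb ^^ k) (unit_mass (0, 0)) \<mu>"
      and supp: "\<And>v. \<mu> v \<noteq> 0 \<Longrightarrow> \<bar>snd v\<bar> \<le> int n"
      and mom: "real k * \<delta> / 2 \<le> mass_sum (\<lambda>v. (real_of_int (snd v))\<^sup>2) \<mu>"
      by auto
    have "?out \<mu> < p" using False reach by (meson not_le order_refl)
    from comb_heavy_vertex[OF reach supp p this n K]
    obtain v where v: "\<bar>snd v\<bar> < int n" "\<delta> \<le> \<mu> v"
      by (auto simp: \<delta>_def)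
    have "0 < \<delta>" using p n K by (simp add: \<delta>_def)
    define \<nu> where "\<nu> = topple comb v (\<mu> v) \<mu>"
    have "toppling_move comb \<mu> \<nu>"
      unfolding toppling_move_def \<nu>_def using v \<open>0 < \<delta>\<close> by (intro exI[of _ v] exI[of _ "\<mu> v"]) auto
    with reach have "(toppling_move comb ^^ Suc k) (unit_mass (0, 0)) \<nu>"
      by auto
    \<comment> \<open>The toppled vertex has height strictly below \<open>n\<close>, so its
      neighbours stay in the closed strip.\<close>
    moreover have "\<bar>snd u\<bar> \<le> int n" if "\<nu> u \<noteq> 0" for u
    proof -
      have "u \<in> {v. \<mu> v \<noteq> 0} \<union> {v} \<union> neighbours comb v"
        using support_topple[of comb v "\<mu> v" \<mu>] that by (auto simp: \<nu>_def)
      then show ?thesis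
        using supp[of u] v(1) by (auto simp: neighbours_def comb_def square_lattice_def)
    qed
    moreover have "real (Suc k) * \<delta> / 2 \<le> mass_sum (\<lambda>v. (real_of_int (snd v))\<^sup>2) \<nu>"
    proof -
      have "\<delta> * (1 / 2) \<le> \<mu> v * laplacian comb (\<lambda>v. (real_of_int (snd v))\<^sup>2) v"
        using v(2) \<open>0 < \<delta>\<close> laplacian_square_height by (intro mult_mono) auto
      moreover have "mass_sum (\<lambda>v. (real_of_int (snd v))\<^sup>2) \<nu> = mass_sum (\<lambda>v. (real_of_int (snd v))\<^sup>2) \<mu>
          + \<mu> v * laplacian comb (\<lambda>v. (real_of_int (snd v))\<^sup>2) v"
        unfolding \<nu>_def using comb_reachable(1)[OF reach] finite_neighbours_comb
        by (rule mass_sum_topple)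
      ultimately show ?thesis using mom by (simp add: field_simps)
    qed
    ultimately show ?thesis by blast
  qed
qed

lemma comb_moves_upper_bound:
  assumes p: "p < 1" and n: "0 < n" and K: "1 \<le> K" "1 / K\<^sup>2 \<le> (1 - p) / 2"
  shows "\<exists>j \<mu>. (toppling_move comb ^^ j) (unit_mass (0, 0)) \<mu>
      \<and> p \<le> mass_sum (indicator (- graph_ball comb (0, 0) n)) \<mu>
      \<and> real j \<le> (24 * K / (1 - p) + 1) * real n powr (7 / 2)"
proof -
  define \<delta> where "\<delta> = (1 - p) / (12 * K * (real n * sqrt (real n)))"
  \<comment> \<open>Chosen so that \<open>N * \<delta> / 2 = n^2\<close>. More than \<open>N\<close>
    moves without success would push the average of \<open>y^2\<close> above its maximum.\<close>
  define N where "N = 24 * K / (1 - p) * real n powr (7 / 2)"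
  define k where "k = nat \<lfloor>N\<rfloor> + 1"
  have "0 < \<delta>" using p n K by (simp add: \<delta>_def)
  have "0 \<le> N" using p K by (simp add: N_def)
  have k: "N < real k" "real k \<le> N + 1"
    using \<open>0 \<le> N\<close> unfolding k_def by linarith+
  have "real n powr (7 / 2) = real n powr (3 + 1 / 2)" by simp
  also have "\<dots> = real n ^ 3 * sqrt (real n)"
    using n by (simp only: powr_add powr_half_sqrt powr_numeral)
  finally have pow: "real n powr (7 / 2) = real n ^ 3 * sqrt (real n)" .
  have N: "N * \<delta> / 2 = (real n)\<^sup>2"
    using p K n by (simp add: N_def \<delta>_def pow field_simps power2_eq_square power3_eq_cube)
  have "\<not> real k * \<delta> / 2 \<le> mass_sum (\<lambda>v. (real_of_int (snd v))\<^sup>2) \<mu>"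
    if reach: "(toppling_move comb ^^ k) (unit_mass (0, 0)) \<mu>"
      and supp: "\<And>v. \<mu> v \<noteq> 0 \<Longrightarrow> \<bar>snd v\<bar> \<le> int n" for \<mu>
  proof -
    have "mass_sum (\<lambda>v. (real_of_int (snd v))\<^sup>2) \<mu> \<le> mass_sum (\<lambda>v. (real n)\<^sup>2) \<mu>"
      using comb_reachable(1)[OF reach]
    proof (rule mass_sum_mono)
      show "(real_of_int (snd v))\<^sup>2 \<le> (real n)\<^sup>2" if "\<mu> v \<noteq> 0" for v
        using supp[OF that] by (intro abs_le_square_iff[THEN iffD1]) linarith
    qed
    also have "\<dots> = N * \<delta> / 2"
      by (simp add: mass_sum_const[of "(real n)\<^sup>2"] comb_reachable(2)[OF reach] N)
    also have "\<dots> < real k * \<delta> / 2"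
      using k \<open>0 < \<delta>\<close> by simp
    finally show ?thesis by simp
  qed
  with comb_greedy[OF p n K, of k] obtain j \<mu> where j: "j \<le> k"
    "(toppling_move comb ^^ j) (unit_mass (0, 0)) \<mu>"
    "p \<le> mass_sum (indicator (- graph_ball comb (0, 0) n)) \<mu>"
    by (fold \<delta>_def) blast
  \<comment> \<open>This absorbs the additional move from rounding \<open>N\<close> up into the
    constant.\<close>
  have "1 \<le> real n powr (7 / 2)"
    using n by (intro ge_one_powr_ge_zero) auto
  then have "real j \<le> (24 * K / (1 - p) + 1) * real n powr (7 / 2)"
    using j(1) k(2) by (simp add: N_def algebra_simps)
  with j show ?thesis by blast
qed

section \<open>From move counts to the toppling number\<close>

text \<open>Reachable distributions have finite support, so the \<open>ennreal\<close> condition on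
  the escaped mass becomes a real inequality.\<close>

lemma toppling_number_comb:
  assumes "0 < p"
  shows "toppling_number p comb A (unit_mass (0, 0)) =
    (INF k \<in> {k. \<exists>\<mu>. (toppling_move comb ^^ k) (unit_mass (0, 0)) \<mu>
                     \<and> p \<le> mass_sum (indicator (- A)) \<mu>}. enat k)"
proof -
  have "ennreal p \<le> (\<Sum>\<^sub>\<infinity>v\<in>-A. ennreal (\<mu> v)) \<longleftrightarrow> p \<le> mass_sum (indicator (- A)) \<mu>"
    if "(toppling_move comb ^^ k) (unit_mass (0, 0)) \<mu>" for k \<mu>
    using assms comb_reachable(1)[OF that]
    by (cases "0 \<le> mass_sum (indicator (- A)) \<mu>")
      (auto simp: infsum_ennreal_eq_mass_sum ennreal_le_iff ennreal_neg)
  then show ?thesis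
    unfolding toppling_number_def by (intro arg_cong[where f = Inf] arg_cong[where f = "image enat"]) blast
qed

theorem theorem1p4:
  fixes p :: real
  assumes "0 < p" and "p < 1"
  shows "\<exists>c C :: real. \<exists>n\<^sub>0 :: nat. 0 < c \<and> c \<le> C \<and>
    (\<forall>n\<ge>n\<^sub>0.
       ennreal (c * real n powr (7 / 2))
         \<le> ennreal_of_enat (toppling_number p comb (graph_ball comb (0, 0) n) (unit_mass (0, 0))) \<and>
       ennreal_of_enat (toppling_number p comb (graph_ball comb (0, 0) n) (unit_mass (0, 0)))
         \<le> ennreal (C * real n powr (7 / 2)))"
proof -
  define c where "c = (p / 2) powr (7 / 4) / 4"
  \<comment> \<open>The value for which \<open>1 / K\<^sup>2\<close> equals
    \<open>(1 - p) / 2\<close>.\<close>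
  define K where "K = sqrt (2 / (1 - p))"
  define C where "C = 24 * K / (1 - p) + 1"
  have K: "1 \<le> K" "1 / K\<^sup>2 \<le> (1 - p) / 2"
    using assms by (simp_all add: K_def)
  have "(p / 2) powr (7 / 4) \<le> 1"
    using assms powr_mono2[of "7 / 4" "p / 2" 1] by simp
  then have "c \<le> 1" by (simp add: c_def)
  moreover have "0 < c" using assms by (simp add: c_def)
  moreover have "1 \<le> C" using assms K by (simp add: C_def)
  moreover have "ennreal (c * real n powr (7 / 2))
         \<le> ennreal_of_enat (toppling_number p comb (graph_ball comb (0, 0) n) (unit_mass (0, 0)))" for n
  proof -
    \<comment> \<open>Rounding up loses nothing because move counts are integers, and it lets the
      infimum be bounded within \<open>enat\<close>.\<close>
    define k where "k = nat \<lceil>c * real n powr (7 / 2)\<rceil>"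
    have "enat k \<le> toppling_number p comb (graph_ball comb (0, 0) n) (unit_mass (0, 0))"
      unfolding toppling_number_comb[OF assms(1)]
    proof (rule INF_greatest)
      fix j assume "j \<in> {k. \<exists>\<mu>. (toppling_move comb ^^ k) (unit_mass (0, 0)) \<mu>
          \<and> p \<le> mass_sum (indicator (- graph_ball comb (0, 0) n)) \<mu>}"
      then have "c * real n powr (7 / 2) \<le> real j"
        using comb_moves_lower_bound[OF _ assms(1)] by (auto simp: c_def)
      then show "enat k \<le> enat j"
        by (simp add: k_def ceiling_le_iff)
    qed
    then have "ennreal_of_enat (enat k)
        \<le> ennreal_of_enat (toppling_number p comb (graph_ball comb (0, 0) n) (unit_mass (0, 0)))"
      by (simp only: ennreal_of_enat_le_iff)
    moreover have "ennreal (c * real n powr (7 / 2)) \<le> ennreal_of_enat (enat k)"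
      by (simp add: k_def ennreal_of_nat_eq_real_of_nat ennreal_leI real_nat_ceiling_ge)
    ultimately show ?thesis by (rule order_trans[rotated])
  qed
  moreover have "ennreal_of_enat (toppling_number p comb (graph_ball comb (0, 0) n) (unit_mass (0, 0)))
         \<le> ennreal (C * real n powr (7 / 2))" if n: "1 \<le> n" for n
  proof -
    from n have "0 < n" by simp
    from comb_moves_upper_bound[OF assms(2) this K]
    obtain j \<mu> where j: "(toppling_move comb ^^ j) (unit_mass (0, 0)) \<mu>"
      "p \<le> mass_sum (indicator (- graph_ball comb (0, 0) n)) \<mu>"
      "real j \<le> C * real n powr (7 / 2)"
      unfolding C_def by blast
    have "toppling_number p comb (graph_ball comb (0, 0) n) (unit_mass (0, 0)) \<le> enat j"
      unfolding toppling_number_comb[OF assms(1)] using j by (intro INF_lower) auto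
    then have "ennreal_of_enat (toppling_number p comb (graph_ball comb (0, 0) n) (unit_mass (0, 0)))
        \<le> ennreal_of_enat (enat j)"
      by (simp only: ennreal_of_enat_le_iff)
    also have "\<dots> \<le> ennreal (C * real n powr (7 / 2))"
      using j(3) by (simp add: ennreal_of_nat_eq_real_of_nat ennreal_leI)
    finally show ?thesis .
  qed
  ultimately show ?thesis
    by (intro exI[of _ c] exI[of _ C] exI[of _ 1]) auto
qed

end
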